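(* Let $p$ and $q$ be distinct primes, and let $G$ be a finite $\{p,q\}$-group. Then $\mathrm{diam}(\Delta(G))=2$ if and only if $|K(G)|>1$.
   Context: For a finite group $G$, the enhanced power graph $\Delta(G)$ is the graph whose vertex set is $G\setminus\{1\}$, where two distinct vertices $x,y$ are joined by an edge if $\langle x,y\rangle$ is cyclic. The diameter $\mathrm{diam}(\Delta(G))$ is the maximum distance between two vertices (infinite if the graph is disconnected). $K(G)=\{x\in G \mid \langle x,g\rangle \text{ is cyclic for all } g\in G\}$, i.e. the set of universal vertices of $\Delta(G)$ (vertices adjacent to all other vertices) together with the identity; it is a subgroup of $G$. A $\{p,q\}$-group is a finite group all of whose order's prime divisors lie in $\{p,q\}$.
   Formalization: G is additionally assumed to be noncyclic: for every nontrivial cyclic {p,q}-group (e.g. the group of order 3) the graph is complete, so its diameter is at most 1, while K(G)=G has more than one element, and the equivalence as stated fails. *)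

theory Defs
  imports
    "HOL-Algebra.Elementary_Groups"
    "HOL-Computational_Algebra.Primes"
    "Graph_Theory.Pair_Digraph"
    "Graph_Theory.Shortest_Path"
begin

definition pi_group :: "nat set \<Rightarrow> ('a, 'b) monoid_scheme \<Rightarrow> bool" where
  "pi_group \<pi> G \<longleftrightarrow>
     group G \<and> finite (carrier G) \<and> (\<forall>r. prime r \<longrightarrow> r dvd order G \<longrightarrow> r \<in> \<pi>)"

text \<open>
  Undirected simple graphs are represented as symmetric loop-free pair digraphs: an edge joining
  x and y is the pair of arcs (x, y) and (y, x).
\<close>

definition enhanced_power_graph :: "('a, 'b) monoid_scheme \<Rightarrow> 'a pair_pre_digraph" where
  "enhanced_power_graph G =
     \<lparr> pverts = carrier G - {\<one>\<^bsub>G\<^esub>},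
       parcs = {(x, y). x \<in> carrier G - {\<one>\<^bsub>G\<^esub>} \<and> y \<in> carrier G - {\<one>\<^bsub>G\<^esub>} \<and> x \<noteq> y \<and>
                        cyclic_group (subgroup_generated G {x, y})} \<rparr>"

lemma pair_graph_enhanced_power_graph:
  assumes "finite (carrier G)"
  shows "pair_graph (enhanced_power_graph G)"
proof
  let ?E = "parcs (enhanced_power_graph G)"
  show "finite ?E"
    by (rule finite_subset[of _ "carrier G \<times> carrier G"])
       (use assms in \<open>auto simp: enhanced_power_graph_def\<close>)
  show "symmetric (with_proj (enhanced_power_graph G))"
    by (auto simp: symmetric_def sym_def enhanced_power_graph_def insert_commute)
qed (use assms in \<open>auto simp: enhanced_power_graph_def\<close>)

text \<open>
  The distance is the cost of a cheapest walk when every arc costs 1; it is \<open>\<infinity>\<close> when there is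
  no walk.  The diameter of the empty graph is \<open>-\<infinity>\<close>, the supremum of the empty set.
\<close>

definition graph_dist :: "'a pair_pre_digraph \<Rightarrow> 'a \<Rightarrow> 'a \<Rightarrow> ereal" where
  "graph_dist \<Gamma> u v = wf_digraph.\<mu> (with_proj \<Gamma>) (\<lambda>_. 1) u v"

definition graph_diam :: "'a pair_pre_digraph \<Rightarrow> ereal" where
  "graph_diam \<Gamma> = (SUP (u, v) \<in> pverts \<Gamma> \<times> pverts \<Gamma>. graph_dist \<Gamma> u v)"

definition cyclicizer :: "('a, 'b) monoid_scheme \<Rightarrow> 'a set" where
  "cyclicizer G =
     {x \<in> carrier G. \<forall>g \<in> carrier G. cyclic_group (subgroup_generated G {x, g})}"

lemma graph_dist_le:
  assumes "pair_wf_digraph \<Gamma>" "(u,v) \<in> parcs \<Gamma>" shows "graph_dist \<Gamma> u v \<le> 1"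
proof -
  interpret pair_wf_digraph \<Gamma> by fact
  have "awalk u [(u,v)] v" using assms(2)
    by (auto simp: awalk_def in_arcsD1 in_arcsD2)
  from min_cost_le_walk_cost[OF this, of "\<lambda>_. 1"] show ?thesis
    by (simp add: graph_dist_def one_ereal_def)
qed

lemma graph_dist_self:
  assumes "pair_wf_digraph \<Gamma>" "u \<in> pverts \<Gamma>" shows "graph_dist \<Gamma> u u = 0"
proof -
  interpret pair_wf_digraph \<Gamma> by fact
  have "awalk u [] u" using assms(2) by (auto simp: awalk_def)
  from min_cost_le_walk_cost[OF this, of "\<lambda>_. 1"] 
  have "graph_dist \<Gamma> u u \<le> 0" by (simp add: graph_dist_def zero_ereal_def)
  moreover have "graph_dist \<Gamma> u u \<ge> 0"
    unfolding graph_dist_def \<mu>_def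
    by (rule INF_greatest) (auto simp: awalk_cost_def intro!: sum_list_nonneg)
  ultimately show ?thesis by simp
qed

lemma (in group) cyclic_pair:
  assumes "cyclic_group G" "x \<in> carrier G" "y \<in> carrier G"
  shows "cyclic_group (subgroup_generated G {x,y})"
proof -
  obtain a where a: "a \<in> carrier G" and "carrier G = range (\<lambda>n::int. a [^] n)"
    using assms(1) cyclic_group by blast
  then obtain i j :: int where ij: "x = a [^] i" "y = a [^] j" using assms by blast
  define z where "z = a [^] gcd i j"
  have z: "z \<in> carrier G" using a by (simp add: z_def)
  obtain s t where st: "s * i + t * j = gcd i j" using bezout_int by blast
  obtain k l where kl: "i = gcd i j * k" "j = gcd i j * l" by (meson dvdE gcd_dvd1 gcd_dvd2)
  have "x = z [^] k" "y = z [^] l" using kl ij a by (auto simp: z_def int_pow_pow)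
  then have "x \<in> generate G {z}" "y \<in> generate G {z}" using z generate_pow by auto
  moreover have "z \<in> generate G {x,y}"
  proof -
    have "z = (x [^] s) \<otimes> (y [^] t)" unfolding z_def ij st[symmetric] using a
      by (simp add: int_pow_pow int_pow_mult mult.commute)
    moreover have "x [^] s \<in> generate G {x,y}" "y [^] t \<in> generate G {x,y}"
      using generate_pow assms mono_generate[of "{x}" "{x,y}"] mono_generate[of "{y}" "{x,y}"] by auto
    ultimately show ?thesis by (simp add: generate.eng)
  qed
  ultimately have "generate G {x,y} = generate G {z}"
    using z assms by (intro equalityI generate_subgroup_incl generate_is_subgroup) auto
  then have "subgroup_generated G {x,y} = subgroup_generated G {z}"
    using z assms by (simp add: subgroup_generated_def)
  then show ?thesis by (metis cyclic_group_generated)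
qed

text \<open>
  In a cyclic group the graph is complete, so its diameter is at most 1 although every element is
  universal.  A characterisation of diameter 2 by a nontrivial cyclicizer therefore concerns
  noncyclic groups only.
\<close>

lemma (in group) cyclic_diam:
  assumes "finite (carrier G)" "cyclic_group G"
  shows "graph_diam (enhanced_power_graph G) \<le> 1" "cyclicizer G = carrier G"
proof -
  interpret g: pair_graph "enhanced_power_graph G" using pair_graph_enhanced_power_graph assms by blast
  note w = g.pair_wf_digraph_axioms
  show "graph_diam (enhanced_power_graph G) \<le> 1" unfolding graph_diam_def
  proof (rule SUP_least, clarify)
    fix u v assume uv: "u \<in> pverts (enhanced_power_graph G)" "v \<in> pverts (enhanced_power_graph G)"
    show "graph_dist (enhanced_power_graph G) u v \<le> 1"
    proof (cases "u = v")
      case True then show ?thesis using graph_dist_self[OF w] uv by simp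
    next
      case False then show ?thesis using graph_dist_le[OF w] uv cyclic_pair[OF assms(2)]
        by (auto simp: enhanced_power_graph_def)
    qed
  qed
  show "cyclicizer G = carrier G" using cyclic_pair[OF assms(2)] by (auto simp: cyclicizer_def)
qed

end

theory Submission
  imports Defs "HOL-Number_Theory.Residues"
begin

text \<open>
  If the diameter is 2, any two nontrivial elements have a common neighbour \<open>z\<close> of prime order
  (up to equality with one of them). A neighbour of prime order \<open>r\<close> of an element of order divisible
  by \<open>r\<close> is a power of it. Hence elements of order \<open>p\<close> commute with elements of order \<open>q\<close>, and comparing
  two products \<open>x y\<close> and \<open>x' y'\<close> of such elements shows that one of the primes, say \<open>p\<close>, admits only
  one subgroup \<open>\<langle>x\<rangle>\<close> of that order. If \<open>x\<close> is central, it is universal. Otherwise some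
  \<open>q\<close>-element \<open>y\<close> does not commute with \<open>x\<close>; a common neighbour of \<open>y\<close> with any element is then not
  of order \<open>p\<close>, so it generates the subgroup of order \<open>q\<close> of \<open>\<langle>y\<rangle>\<close>, which is therefore universal.
\<close>

section \<open>Powers of a single element\<close>

lemma (in group) generate_trans:
  assumes "x \<in> generate G {y}" "y \<in> generate G {z}" "z \<in> carrier G"
  shows "x \<in> generate G {z}"
  using assms generate_subgroup_incl[of "{y}" "generate G {z}"] generate_is_subgroup[of "{z}"]
  by auto

lemma (in group) generate_singleton_closed:
  assumes "x \<in> generate G {y}" "y \<in> carrier G"
  shows "x \<in> carrier G"
  using assms generate_incl[of "{y}"] by auto

lemma (in group) inv_mult_cancel_left:
  assumes "x \<in> carrier G" "y \<in> carrier G"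
  shows "inv x \<otimes> (x \<otimes> y) = y"
  using assms by (simp flip: m_assoc)

lemma (in group) int_pow_in_generate:
  assumes "x \<in> carrier G"
  shows "x [^] (i::int) \<in> generate G {x}"
  using generate_pow[OF assms] by auto

lemma (in group) nat_pow_in_generate:
  assumes "x \<in> carrier G"
  shows "x [^] (n::nat) \<in> generate G {x}"
  using int_pow_in_generate[OF assms, of "int n"] by (simp add: int_pow_int)

lemma (in group) commute_generate:
  assumes "finite (carrier G)" "x \<in> carrier G" "y \<in> carrier G" "x \<otimes> y = y \<otimes> x"
    and "z \<in> generate G {x}"
  shows "z \<otimes> y = y \<otimes> z"
  using assms group_commutes_pow[OF assms(4,2,3)] generate_pow_on_finite_carrier[OF assms(1,2)]
  by auto

section \<open>Pairs of elements in a common cyclic subgroup\<close>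

text \<open>A generator of the joint subgroup serves as \<open>c\<close>; conversely, subgroups of a
  cyclic group are cyclic, by \<open>cyclic_pair\<close> inside the subgroup generated by
  \<open>c\<close>. Adjacency thus becomes membership in cyclic subgroups.\<close>

lemma (in group) cyclic_pair_iff:
  assumes "x \<in> carrier G" "y \<in> carrier G"
  shows "cyclic_group (subgroup_generated G {x, y}) \<longleftrightarrow>
    (\<exists>c \<in> carrier G. x \<in> generate G {c} \<and> y \<in> generate G {c})" (is "?L \<longleftrightarrow> ?R")
proof
  let ?H = "subgroup_generated G {x, y}"
  interpret H: group ?H by simp
  assume ?L
  then obtain c where c: "c \<in> carrier ?H" and eq: "carrier ?H = range (\<lambda>n::int. c [^]\<^bsub>?H\<^esub> n)"
    using H.cyclic_group by blast
  have cG: "c \<in> carrier G" using c carrier_subgroup_generated_subset by blast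
  have "carrier ?H \<subseteq> generate G {c}"
    using eq int_pow_in_generate[OF cG] int_pow_subgroup_generated[OF c] by auto
  moreover have "x \<in> carrier ?H" "y \<in> carrier ?H"
    using assms by (auto simp: carrier_subgroup_generated intro: generate.incl)
  ultimately show ?R using cG by blast
next
  assume ?R
  then obtain c where c: "c \<in> carrier G" "x \<in> generate G {c}" "y \<in> generate G {c}" by blast
  let ?H = "subgroup_generated G {c}"
  interpret H: group ?H by simp
  have cH: "carrier ?H = generate G {c}" using c by (simp add: carrier_subgroup_generated)
  have "cyclic_group (subgroup_generated ?H {x, y})"
    using H.cyclic_pair[OF cyclic_group_generated] c cH by simp
  \<comment> \<open>The pair generates the same subgroup inside \<open>?H\<close> as inside
    \<open>G\<close>.\<close>
  moreover have "generate ?H {x, y} = generate G {x, y}"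
    using generate_consistent[of "{x, y}" "generate G {c}"] c generate_is_subgroup[of "{c}"]
    by (simp add: subgroup_generated_def)
  then have "subgroup_generated ?H {x, y} = subgroup_generated G {x, y}"
    using c assms cH by (simp add: subgroup_generated_def)
  ultimately show ?L by simp
qed

lemma (in group) cyclic_pair_swap:
  "cyclic_group (subgroup_generated G {x, y}) \<longleftrightarrow> cyclic_group (subgroup_generated G {y, x})"
  by (simp add: insert_commute)

lemma (in group) cyclic_pair_generate:
  assumes "x \<in> carrier G" "y \<in> generate G {x}"
  shows "cyclic_group (subgroup_generated G {x, y})"
  using assms cyclic_pair_iff generate_singleton_closed generate.incl by (metis singletonI)

lemma (in group) cyclic_pair_mono:
  assumes "x \<in> carrier G" "y \<in> carrier G" "cyclic_group (subgroup_generated G {x, y})"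
    and "z \<in> generate G {y}"
  shows "cyclic_group (subgroup_generated G {x, z})"
  using assms cyclic_pair_iff generate_singleton_closed generate_trans by (metis (no_types))

lemma (in group) cyclic_pair_commute:
  assumes "x \<in> carrier G" "y \<in> carrier G" "cyclic_group (subgroup_generated G {x, y})"
  shows "x \<otimes> y = y \<otimes> x"
proof -
  obtain c where "c \<in> carrier G" "x \<in> generate G {c}" "y \<in> generate G {c}"
    using assms cyclic_pair_iff by blast
  then show ?thesis using generate_pow by (auto simp: add.commute simp flip: int_pow_mult)
qed

section \<open>Elements of prime order in cyclic groups\<close>

text \<open>A cyclic group has at most one subgroup of order \<open>r\<close>. Both \<open>z\<close>
  and a power \<open>x'\<close> of \<open>x\<close> generate it.\<close>

lemma (in group) cyclic_pair_prime_ord: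
  assumes "finite (carrier G)" "x \<in> carrier G" "z \<in> carrier G"
    and cyc: "cyclic_group (subgroup_generated G {x, z})"
    and r: "prime r" "ord z = r" "r dvd ord x"
  shows "z \<in> generate G {x}"
proof -
  obtain c where c: "c \<in> carrier G" "x \<in> generate G {c}" "z \<in> generate G {c}"
    using assms cyclic_pair_iff by blast
  obtain i j where i: "x = c [^] (i::nat)" and j: "z = c [^] (j::nat)"
    using c generate_pow_on_finite_carrier[OF assms(1)] by blast
  define x' where "x' = x [^] (ord x div r)"
  have "ord x > 0" using ord_ge_1[OF assms(1,2)] by simp
  then have x': "x' \<in> generate G {x}" "ord x' = r" "x' \<in> carrier G"
    using r assms(2) by (auto simp: x'_def ord_pow div_dvd_iff_mult nat_pow_in_generate)
  define k where "k = i * (ord x div r)"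
  have k: "x' = c [^] k" using c(1) by (simp add: x'_def i k_def nat_pow_pow)
  \<comment> \<open>Powers of \<open>c\<close> killed by \<open>r\<close> are powers of
    \<open>c [^] M\<close>; this applies to both \<open>x'\<close> and \<open>z\<close>.\<close>
  define M where "M = ord c div r"
  have "r dvd ord c"
    using r(2) c(1) j ord_pow_gen[OF c(1), of j] \<open>prime r\<close>
    by (metis dvd_triv_right dvd_div_mult_self gcd_dvd1 not_prime_1 dvd_triv_left)
  then have N: "ord c = r * M" by (simp add: M_def)
  have dvd: "M dvd n" if "(c [^] n) [^] r = \<one>" for n :: nat
  proof -
    have "ord c dvd n * r" using that c(1) pow_eq_id by (simp add: nat_pow_pow)
    then show ?thesis using N r(1) by (simp add: mult.commute[of r] prime_gt_0_nat)
  qed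
  obtain i' where i': "k = M * i'" using dvd[of k] x' k by (metis dvdE pow_ord_eq_1)
  obtain j' where j': "j = M * j'" using dvd[of j] j r(2) assms(3) by (metis dvdE pow_ord_eq_1)
  define d where "d = c [^] M"
  have d: "d \<in> carrier G" "d [^] r = \<one>" "x' = d [^] i'" "z = d [^] j'"
    using c(1) N by (auto simp: d_def nat_pow_pow mult.commute i' k j j' pow_eq_id)
  have "x' \<noteq> \<one>" using x'(2) r(1) by auto
  \<comment> \<open>Since \<open>i'\<close> is invertible modulo \<open>r\<close>, the passage from
    \<open>d\<close> to \<open>x'\<close> can be undone by a further power.\<close>
  then have "\<not> r dvd i'" using d pow_eq_id by (metis dvd_trans)
  then have "coprime (int i') (int r)" using prime_imp_coprime[OF r(1), of i'] by (simp add: coprime_commute)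
  then obtain s t where st: "s * int i' + t * int r = 1"
    using bezout_int[of "int i'" "int r"] by auto
  have "d = d [^] (s * int i' + t * int r)" using st d(1) by simp
  also have "\<dots> = x' [^] s"
    using d by (simp add: int_pow_mult int_pow_pow[symmetric] mult.commute[of s] mult.commute[of t] int_pow_int)
  finally have "d \<in> generate G {x'}" using x' int_pow_in_generate by metis
  then have "z \<in> generate G {x'}" using d nat_pow_in_generate generate_trans x'(3) by metis
  then show ?thesis using x' assms(2) generate_trans by blast
qed

text \<open>Both \<open>x\<close> and \<open>z\<close> generate the only subgroup of order
  \<open>r\<close> in the cyclic group generated by \<open>u\<close>.\<close>

lemma (in group) cyclic_pair_prime_ord_eq:
  assumes "finite (carrier G)" "u \<in> carrier G" "x \<in> carrier G" "z \<in> carrier G"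
    and "cyclic_group (subgroup_generated G {u, x})" "cyclic_group (subgroup_generated G {u, z})"
    and r: "prime r" "ord z = r" "ord x = r" "r dvd ord u"
  shows "z \<in> generate G {x}"
proof -
  have "x \<in> generate G {u}" "z \<in> generate G {u}" using cyclic_pair_prime_ord assms by blast+
  then have "cyclic_group (subgroup_generated G {x, z})" using cyclic_pair_iff assms by blast
  then show ?thesis using cyclic_pair_prime_ord assms by simp
qed

lemma (in group) prime_ord_generate_sym:
  assumes "finite (carrier G)" "x \<in> carrier G" "z \<in> generate G {x}" "prime r" "ord z = r" "ord x = r"
  shows "x \<in> generate G {z}"
  using assms cyclic_pair_prime_ord[of z x r] cyclic_pair_generate[of x z] cyclic_pair_swap[of x z]
    generate_singleton_closed by simp

text \<open>
  If \<open>w\<close> acts on \<open>\<langle>x\<rangle>\<close> by \<open>x \<mapsto> x\<^sup>a\<close>, then \<open>w\<^bsup>p\<^sup>k\<^esup> = 1\<close> acts by \<open>a\<^bsup>p\<^sup>k\<^esup> \<equiv> a (mod p)\<close>.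
\<close>

lemma (in group) unique_prime_ord_commute:
  assumes "finite (carrier G)" "x \<in> carrier G" "w \<in> carrier G" "prime p" "ord x = p"
    and uniq: "\<And>y. y \<in> carrier G \<Longrightarrow> ord y = p \<Longrightarrow> y \<in> generate G {x}"
    and w: "w [^] (p ^ k) = \<one>"
  shows "x \<otimes> w = w \<otimes> x"
proof -
  \<comment> \<open>Conjugation preserves the order \<open>p\<close>, so \<open>uniq\<close> makes
    \<open>f x\<close> a power of \<open>x\<close>.\<close>
  define f where "f = (\<lambda>y. w \<otimes> y \<otimes> inv w)"
  have f_mult: "f (y \<otimes> z) = f y \<otimes> f z" if "y \<in> carrier G" "z \<in> carrier G" for y z
    using that assms(3) by (simp add: f_def m_assoc inv_mult_cancel_left)
  have f_pow: "f (y [^] (n::nat)) = f y [^] n" if "y \<in> carrier G" for y n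
    using that assms(3) by (induction n) (simp_all add: f_mult, simp add: f_def)
  have f_one: "f y = \<one> \<longleftrightarrow> y = \<one>" if "y \<in> carrier G" for y
    using that assms(3) by (simp add: f_def inv_solve_right')
  have fc: "f x \<in> carrier G" using assms by (simp add: f_def)
  have "f x [^] p = \<one>" using f_pow[OF assms(2), of p] f_one[of \<one>] pow_ord_eq_1[OF assms(2)] assms(5) by simp
  then have "ord (f x) dvd p" using pow_eq_id[OF fc] by simp
  moreover have "ord (f x) \<noteq> 1" using ord_eq_1[OF fc] f_one ord_eq_1[OF assms(2)] assms by auto
  ultimately have "ord (f x) = p" using \<open>prime p\<close> prime_nat_iff by blast
  then obtain a where a: "f x = x [^] (a::nat)"
    using uniq[OF fc] generate_pow_on_finite_carrier[OF assms(1,2)] by blast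
  have it: "w [^] n \<otimes> x \<otimes> inv (w [^] n) = x [^] (a ^ n)" for n :: nat
  proof (induction n)
    case (Suc n)
    have "w [^] Suc n \<otimes> x \<otimes> inv (w [^] Suc n) = f (w [^] n \<otimes> x \<otimes> inv (w [^] n))"
      using assms(2,3) unfolding nat_pow_Suc2[OF assms(3)]
      by (simp add: f_def m_assoc inv_mult_group)
    also have "\<dots> = x [^] (a ^ Suc n)"
      using f_pow[OF assms(2)] a assms(2) by (simp add: Suc nat_pow_pow)
    finally show ?case .
  qed (use assms in simp)
  \<comment> \<open>Fermat's little theorem in the form that includes multiples of \<open>p\<close>,
    ready for iteration.\<close>
  have "[a ^ p = a] (mod p)"
  proof (cases "p dvd a")
    case True then show ?thesis
      using prime_gt_0_nat[OF \<open>prime p\<close>] by (simp add: cong_def mod_eq_0_iff_dvd dvd_power_same)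
        (metis dvd_imp_mod_0 dvd_power dvd_trans)
  next
    case False
    from cong_mult[OF fermat_theorem[OF \<open>prime p\<close> False] cong_refl[of a]] show ?thesis
      using prime_gt_0_nat[OF \<open>prime p\<close>] by (metis mult_1 power_minus_mult)
  qed
  then have "[a ^ (p ^ k) = a] (mod p)"
    by (induction k) (auto simp: power_mult power_Suc2 simp del: power_Suc dest: cong_pow cong_trans)
  then have "[int (a ^ (p ^ k)) = int a] (mod int p)" by (simp only: cong_int_iff)
  then have "int p dvd int (a ^ (p ^ k)) - int a" by (simp add: cong_iff_dvd_diff)
  then have "x [^] (a ^ (p ^ k)) = x [^] a"
    using int_pow_eq[OF assms(2), of "int a" "int (a ^ (p ^ k))"] assms(5)
    unfolding int_pow_int by (metis dvd_minus_iff minus_diff_eq)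
  \<comment> \<open>As \<open>w [^] (p ^ k)\<close> is trivial, \<open>it\<close> says that
    \<open>x\<close> equals \<open>x [^] (a ^ (p ^ k))\<close>, which is \<open>x [^] a\<close>,
    that is \<open>f x\<close>.\<close>
  then have "f x = x" using it[of "p ^ k"] w a assms(2) by simp
  then show ?thesis using assms(2,3) by (metis f_def inv_solve_right m_closed)
qed

section \<open>Coprime orders and universal elements\<close>

text \<open>Raising the product to the power \<open>ord g\<close> kills \<open>g\<close> and leaves
  a power of \<open>x\<close> that still generates \<open>x\<close>, by coprimality.\<close>

lemma (in group) coprime_ord_in_generate:
  assumes "x \<in> carrier G" "g \<in> carrier G" "x \<otimes> g = g \<otimes> x" "coprime (ord x) (ord g)"
  shows "x \<in> generate G {x \<otimes> g}" "g \<in> generate G {x \<otimes> g}"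
proof -
  define n where "n = ord g"
  have xg: "x \<otimes> g \<in> carrier G" using assms by simp
  obtain s t where st: "s * int n + t * int (ord x) = 1"
    using assms(4) bezout_int[of "int n" "int (ord x)"] by (auto simp: n_def coprime_commute)
  have "(x \<otimes> g) [^] n = x [^] n"
    using pow_mult_distrib[OF assms(3,1,2)] assms(1,2) by (simp add: n_def)
  then have "x [^] n \<in> generate G {x \<otimes> g}" using nat_pow_in_generate[OF xg, of n] by simp
  moreover have "x = (x [^] n) [^] s"
  proof -
    have "x = x [^] (s * int n + t * int (ord x))" using st assms(1) by simp
    also have "\<dots> = (x [^] n) [^] s \<otimes> (x [^] ord x) [^] t"
      using assms(1)
      by (simp add: int_pow_mult int_pow_pow mult.commute[of s] mult.commute[of t]
          del: pow_ord_eq_1 flip: int_pow_int)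
    finally show ?thesis using assms(1) pow_ord_eq_1[OF assms(1)] by simp
  qed
  ultimately show x: "x \<in> generate G {x \<otimes> g}"
    using int_pow_in_generate generate_trans xg by (metis assms(1) nat_pow_closed)
  have "inv x \<otimes> (x \<otimes> g) \<in> generate G {x \<otimes> g}"
    using x xg generate_is_subgroup[of "{x \<otimes> g}"] generate.incl[of "x \<otimes> g"]
    by (auto intro: subgroup.m_closed subgroup.m_inv_closed)
  then show "g \<in> generate G {x \<otimes> g}" using inv_mult_cancel_left[OF assms(1,2)] by simp
qed

text \<open>If \<open>p\<close> divides \<open>ord g\<close>, the powers of \<open>g\<close> include
  an element of order \<open>p\<close>, hence \<open>x\<close> by uniqueness. Otherwise the orders
  are coprime and \<open>x \<otimes> g\<close> generates both elements.\<close>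

lemma (in group) unique_central_prime_ord_cyclicizer:
  assumes "finite (carrier G)" "x \<in> carrier G" "prime p" "ord x = p"
    and uniq: "\<And>y. y \<in> carrier G \<Longrightarrow> ord y = p \<Longrightarrow> y \<in> generate G {x}"
    and cent: "\<And>g. g \<in> carrier G \<Longrightarrow> x \<otimes> g = g \<otimes> x"
  shows "x \<in> cyclicizer G"
proof -
  have "cyclic_group (subgroup_generated G {x, g})" if g: "g \<in> carrier G" for g
  proof (cases "p dvd ord g")
    case True
    define y where "y = g [^] (ord g div p)"
    have "ord g > 0" using ord_ge_1[OF assms(1) g] by simp
    then have y: "y \<in> generate G {g}" "ord y = p" "y \<in> carrier G"
      using True g by (auto simp: y_def ord_pow div_dvd_iff_mult nat_pow_in_generate)
    then have "x \<in> generate G {y}" using prime_ord_generate_sym uniq assms by metis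
    then have "x \<in> generate G {g}" using y g generate_trans by blast
    then show ?thesis using cyclic_pair_generate g cyclic_pair_swap by blast
  next
    case False
    then have "coprime (ord x) (ord g)" using prime_imp_coprime \<open>prime p\<close> assms(4) by blast
    then have "x \<in> generate G {x \<otimes> g}" "g \<in> generate G {x \<otimes> g}"
      using coprime_ord_in_generate[OF assms(2) g cent[OF g]] by auto
    then show ?thesis using cyclic_pair_iff assms g by blast
  qed
  then show ?thesis using assms by (simp add: cyclicizer_def)
qed

section \<open>Orders of powers and their prime factors\<close>

lemma (in group) ord_dvd_ord_generate:
  assumes "finite (carrier G)" "u \<in> carrier G" "x \<in> generate G {u}"
  shows "ord x dvd ord u"
proof -
  obtain k :: nat where k: "x = u [^] k"
    using assms generate_pow_on_finite_carrier by blast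
  have "(u [^] k) [^] ord u = \<one>"
    using assms(2) by (simp add: nat_pow_pow pow_eq_id)
  then show ?thesis using k assms(2) pow_eq_id by simp
qed

lemma (in group) ex_generate_prime_ord:
  assumes "finite (carrier G)" "x \<in> carrier G" "prime r" "r dvd ord x"
  obtains z where "z \<in> generate G {x}" "z \<in> carrier G" "ord z = r"
proof
  have "ord x > 0" using ord_ge_1[OF assms(1,2)] by simp
  then show "ord (x [^] (ord x div r)) = r"
    using assms by (auto simp: ord_pow div_dvd_iff_mult)
qed (use assms nat_pow_in_generate in auto)

text \<open>Removing the full power of \<open>p\<close> and then that of \<open>q\<close> leaves a
  cofactor without prime divisors.\<close>

lemma eq_prime_powers_mult:
  fixes n p q :: nat
  assumes "n > 0" "prime p" "prime q" "\<And>r. prime r \<Longrightarrow> r dvd n \<Longrightarrow> r = p \<or> r = q"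
  obtains a b where "n = p ^ a * q ^ b"
proof -
  obtain a m where m: "n = p ^ a * m" "\<not> p dvd m"
    using multiplicity_decompose'[of n p] assms by (metis gr_implies_not0 not_prime_unit)
  obtain b l where l: "m = q ^ b * l" "\<not> q dvd l"
    using multiplicity_decompose'[of m q] assms m
    by (metis gr_implies_not0 not_prime_unit mult_0_right)
  have "l = 1"
  proof (rule ccontr)
    assume "l \<noteq> 1"
    then obtain r where "prime r" "r dvd l" using prime_factor_nat by blast
    then show False using m l assms(4)[of r] by auto
  qed
  then show ?thesis using that m l by simp
qed

section \<open>Consequences of common neighbours for two primes\<close>

text \<open>The axiom \<open>common\<close> expresses diameter at most 2 without graphs:
  \<open>z\<close> may coincide with \<open>x\<close> or \<open>y\<close>, which absorbs distances 0
  and 1.\<close>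

locale two_prime_group = group G for G (structure) +
  fixes p q :: nat
  assumes fin: "finite (carrier G)" and prime_p: "prime p" and prime_q: "prime q" and neq: "p \<noteq> q"
    and prime_dvd_ord: "\<And>g r. g \<in> carrier G \<Longrightarrow> prime r \<Longrightarrow> r dvd ord g \<Longrightarrow> r = p \<or> r = q"
    and common: "\<And>x y. x \<in> carrier G \<Longrightarrow> y \<in> carrier G \<Longrightarrow> x \<noteq> \<one> \<Longrightarrow> y \<noteq> \<one> \<Longrightarrow>
      \<exists>z \<in> carrier G. z \<noteq> \<one> \<and> cyclic_group (subgroup_generated G {x, z}) \<and>
        cyclic_group (subgroup_generated G {y, z})"
begin

text \<open>The symmetry of the axioms lets each later result be used with the primes
  exchanged.\<close>

lemma two_prime_group_swap: "two_prime_group G q p"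
  using fin prime_p prime_q neq prime_dvd_ord common by unfold_locales blast+

lemma ex_prime_ord:
  assumes "x \<in> carrier G" "x \<noteq> \<one>"
  obtains z where "z \<in> generate G {x}" "z \<in> carrier G" "ord z = p \<or> ord z = q"
proof -
  obtain r where r: "prime r" "r dvd ord x"
    using prime_factor_nat assms ord_eq_1 by metis
  then show ?thesis using that ex_generate_prime_ord[OF fin assms(1) r] prime_dvd_ord assms by metis
qed

text \<open>Adjacency passes to powers, so a common neighbour may be replaced by a power of prime
  order.\<close>

lemma common_prime_ord:
  assumes "x \<in> carrier G" "y \<in> carrier G" "x \<noteq> \<one>" "y \<noteq> \<one>"
  obtains z where "z \<in> carrier G" "ord z = p \<or> ord z = q"
    "cyclic_group (subgroup_generated G {x, z})" "cyclic_group (subgroup_generated G {y, z})"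
proof -
  obtain z where z: "z \<in> carrier G" "z \<noteq> \<one>"
    "cyclic_group (subgroup_generated G {x, z})" "cyclic_group (subgroup_generated G {y, z})"
    using common assms by blast
  then obtain z' where "z' \<in> generate G {z}" "z' \<in> carrier G" "ord z' = p \<or> ord z' = q"
    using ex_prime_ord by blast
  then show ?thesis using that cyclic_pair_mono z assms by blast
qed

lemma ord_prime_neq_one: "ord x = p \<or> ord x = q \<Longrightarrow> x \<noteq> \<one>"
  using prime_p prime_q by auto

text \<open>Having the same prime order in a common cyclic group, \<open>x\<close> is a power of
  \<open>z\<close>, and \<open>z\<close> commutes with \<open>y\<close>.\<close>

lemma commute_if_cyclic_pair_ord_p:
  assumes "x \<in> carrier G" "y \<in> carrier G" "z \<in> carrier G" "ord x = p" "ord z = p"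
    "cyclic_group (subgroup_generated G {x, z})" "cyclic_group (subgroup_generated G {y, z})"
  shows "x \<otimes> y = y \<otimes> x"
proof -
  have "x \<in> generate G {z}"
    using cyclic_pair_prime_ord[OF fin, of z x p] assms prime_p cyclic_pair_swap by simp
  then show ?thesis using commute_generate fin assms cyclic_pair_commute by metis
qed

text \<open>A common neighbour of prime order has the order of \<open>x\<close> or of
  \<open>y\<close>, so it generates the same subgroup as that element.\<close>

lemma ord_p_q_commute:
  assumes "x \<in> carrier G" "y \<in> carrier G" "ord x = p" "ord y = q"
  shows "x \<otimes> y = y \<otimes> x"
proof -
  interpret swap: two_prime_group G q p by (rule two_prime_group_swap)
  obtain z where "z \<in> carrier G" "ord z = p \<or> ord z = q"
    "cyclic_group (subgroup_generated G {x, z})" "cyclic_group (subgroup_generated G {y, z})"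
    using common_prime_ord[of x y] assms ord_prime_neq_one by metis
  then show ?thesis
    using commute_if_cyclic_pair_ord_p swap.commute_if_cyclic_pair_ord_p assms by metis
qed

text \<open>The orders of \<open>x \<otimes> y\<close> and \<open>x' \<otimes> y'\<close> are
  divisible by both primes. A common neighbour of order \<open>p\<close> therefore generates the
  same subgroup as \<open>x\<close> and as \<open>x'\<close>; one of order \<open>q\<close> does so
  for \<open>y\<close> and \<open>y'\<close>.\<close>

lemma generate_eq_or_generate_eq:
  assumes "x \<in> carrier G" "x' \<in> carrier G" "y \<in> carrier G" "y' \<in> carrier G"
    "ord x = p" "ord x' = p" "ord y = q" "ord y' = q"
  shows "x' \<in> generate G {x} \<or> y' \<in> generate G {y}"
proof -
  have cop: "coprime p q" using primes_coprime prime_p prime_q neq by blast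
  have *: "u \<in> carrier G \<and> p dvd ord u \<and> q dvd ord u \<and> u \<noteq> \<one> \<and>
      cyclic_group (subgroup_generated G {u, a}) \<and> cyclic_group (subgroup_generated G {u, b})"
    if "a \<in> carrier G" "b \<in> carrier G" "ord a = p" "ord b = q" "u = a \<otimes> b" for a b u
  proof -
    have ab: "a \<in> generate G {u}" "b \<in> generate G {u}" and u: "u \<in> carrier G"
      using coprime_ord_in_generate[OF that(1,2) ord_p_q_commute] that cop by simp_all
    then have d: "p dvd ord u" "q dvd ord u" using ord_dvd_ord_generate fin that by metis+
    then have "u \<noteq> \<one>" using prime_p by auto
    with ab u d show ?thesis using cyclic_pair_generate by blast
  qed
  note u = *[OF assms(1,3,5,7) refl] and u' = *[OF assms(2,4,6,8) refl]
  \<comment> \<open>The common neighbour \<open>z\<close> links the subgroups of order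
    \<open>r\<close> below \<open>u\<close> and \<open>u'\<close>. Stated for a general prime
    \<open>r\<close>, this serves both cases.\<close>
  have gen: "a' \<in> generate G {a}"
    if "prime r" "r dvd ord u" "r dvd ord u'" "a \<in> carrier G" "a' \<in> carrier G" "ord a = r"
      "ord a' = r" "u \<in> carrier G" "u' \<in> carrier G" "z \<in> carrier G" "ord z = r"
      "cyclic_group (subgroup_generated G {u, a})" "cyclic_group (subgroup_generated G {u', a'})"
      "cyclic_group (subgroup_generated G {u, z})" "cyclic_group (subgroup_generated G {u', z})"
    for a a' u u' z r
  proof -
    have "z \<in> generate G {a}" using cyclic_pair_prime_ord_eq[OF fin, of u a z r] that by blast
    moreover have "a' \<in> generate G {z}"
      using cyclic_pair_prime_ord_eq[OF fin, of u' z a' r] that by blast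
    ultimately show ?thesis using generate_trans that by blast
  qed
  obtain z where "z \<in> carrier G" "ord z = p \<or> ord z = q"
    "cyclic_group (subgroup_generated G {x \<otimes> y, z})"
    "cyclic_group (subgroup_generated G {x' \<otimes> y', z})"
    using common_prime_ord u u' by blast
  then show ?thesis
    using gen[of p "x \<otimes> y" "x' \<otimes> y'" x x' z] gen[of q "x \<otimes> y" "x' \<otimes> y'" y y' z]
      u u' assms prime_p prime_q by blast
qed

text \<open>This replaces the comparison of products when no element of order \<open>q\<close>
  exists: the common neighbour must then have order \<open>p\<close>.\<close>

lemma generate_eq_if_no_ord_q:
  assumes "x \<in> carrier G" "x' \<in> carrier G" "ord x = p" "ord x' = p"
    and "\<And>y. y \<in> carrier G \<Longrightarrow> ord y \<noteq> q"
  shows "x' \<in> generate G {x}"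
proof -
  obtain z where z: "z \<in> carrier G" "ord z = p"
    "cyclic_group (subgroup_generated G {x, z})" "cyclic_group (subgroup_generated G {x', z})"
    using common_prime_ord[of x x'] assms ord_prime_neq_one by metis
  then have "z \<in> generate G {x}" "x' \<in> generate G {z}"
    using cyclic_pair_prime_ord[OF fin, of x z p] cyclic_pair_prime_ord[OF fin, of z x' p]
      cyclic_pair_swap assms prime_p by simp_all
  then show ?thesis using generate_trans assms by blast
qed

text \<open>Every \<open>g\<close> is a product of powers of itself whose orders are powers of
  \<open>p\<close> and of \<open>q\<close>.\<close>

lemma commute_if_commute_prime_power_ord:
  assumes "x \<in> carrier G" "g \<in> carrier G"
    and "\<And>w k. w \<in> carrier G \<Longrightarrow> w [^] (p ^ k) = \<one> \<Longrightarrow> x \<otimes> w = w \<otimes> x"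
    and "\<And>w k. w \<in> carrier G \<Longrightarrow> w [^] (q ^ k) = \<one> \<Longrightarrow> x \<otimes> w = w \<otimes> x"
  shows "x \<otimes> g = g \<otimes> x"
proof -
  obtain a b where ab: "ord g = p ^ a * q ^ b"
    using eq_prime_powers_mult[of "ord g" p q] ord_ge_1[OF fin assms(2)] prime_p prime_q
      prime_dvd_ord[OF assms(2)] by (metis less_le_trans zero_less_one)
  have "coprime (int (p ^ a)) (int (q ^ b))"
    using primes_coprime[OF prime_p prime_q neq] by simp
  then obtain s t where st: "s * int (p ^ a) + t * int (q ^ b) = 1"
    using bezout_int[of "int (p ^ a)" "int (q ^ b)"] by auto
  \<comment> \<open>Here \<open>u\<close> has \<open>q\<close>-power order and \<open>v\<close> has
    \<open>p\<close>-power order; the Bezout coefficients recover \<open>g\<close> from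
    them.\<close>
  define u v where "u = g [^] (p ^ a)" and "v = g [^] (q ^ b)"
  have uv: "u \<in> carrier G" "v \<in> carrier G" using assms by (simp_all add: u_def v_def)
  have "u [^] (q ^ b) = \<one>" "v [^] (p ^ a) = \<one>"
    using assms(2) ab by (simp_all add: u_def v_def nat_pow_pow pow_eq_id mult.commute)
  then have "u \<otimes> x = x \<otimes> u" "v \<otimes> x = x \<otimes> v" using assms uv by metis+
  then have c: "u [^] s \<otimes> x = x \<otimes> u [^] s" "v [^] t \<otimes> x = x \<otimes> v [^] t"
    using commute_generate fin uv assms(1) int_pow_in_generate by metis+
  have "g = g [^] (s * int (p ^ a) + t * int (q ^ b))" using st assms(2) by simp
  also have "\<dots> = u [^] s \<otimes> v [^] t"
    unfolding u_def v_def using assms(2)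
    by (simp add: int_pow_mult int_pow_pow mult.commute[of s] mult.commute[of t]
        del: of_nat_power flip: int_pow_int)
  finally have g: "g = u [^] s \<otimes> v [^] t" .
  have "x \<otimes> g = (x \<otimes> u [^] s) \<otimes> v [^] t" using g uv assms by (simp add: m_assoc)
  also have "\<dots> = u [^] s \<otimes> (x \<otimes> v [^] t)" using c uv assms by (simp add: m_assoc flip: c(1))
  also have "\<dots> = g \<otimes> x" using g uv assms by (simp add: m_assoc flip: c(2))
  finally show ?thesis .
qed

text \<open>Uniqueness already makes \<open>x\<close> commute with all \<open>p\<close>-elements.
  Either it also commutes with all \<open>q\<close>-elements and is central, or a
  \<open>q\<close>-element \<open>y\<close> not commuting with \<open>x\<close> has a universal
  power \<open>y0\<close>.\<close>

lemma unique_ord_p_imp_cyclicizer: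
  assumes "x \<in> carrier G" "ord x = p"
    and uniq: "\<And>x'. x' \<in> carrier G \<Longrightarrow> ord x' = p \<Longrightarrow> x' \<in> generate G {x}"
  shows "\<exists>z \<in> cyclicizer G. z \<noteq> \<one>"
proof (cases "\<forall>w \<in> carrier G. \<forall>k. w [^] (q ^ k) = \<one> \<longrightarrow> x \<otimes> w = w \<otimes> x")
  case True
  have "x \<otimes> w = w \<otimes> x" if "w \<in> carrier G" "w [^] (p ^ k) = \<one>" for w k
    using unique_prime_ord_commute fin assms prime_p that by metis
  then have "x \<otimes> g = g \<otimes> x" if "g \<in> carrier G" for g
    using commute_if_commute_prime_power_ord assms that True by metis
  then have "x \<in> cyclicizer G"
    using unique_central_prime_ord_cyclicizer fin assms prime_p by metis
  then show ?thesis using ord_prime_neq_one assms by blast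
next
  case False
  then obtain y k where y: "y \<in> carrier G" "y [^] (q ^ k) = \<one>" "x \<otimes> y \<noteq> y \<otimes> x" by blast
  then have y1: "y \<noteq> \<one>" using assms by auto
  have "ord y dvd q ^ k" using y pow_eq_id by blast
  then have "q dvd ord y"
    using y1 ord_eq_1[OF y(1)] prime_q divides_primepow_nat by (metis dvd_power not_gr0 power_0)
  then obtain y0 where y0: "y0 \<in> generate G {y}" "y0 \<in> carrier G" "ord y0 = q"
    using ex_generate_prime_ord[OF fin y(1) prime_q] by blast
  have "cyclic_group (subgroup_generated G {y0, w})" if w: "w \<in> carrier G" for w
  proof (cases "w = \<one>")
    case True
    then show ?thesis using cyclic_pair_generate y0 generate.one by blast
  next
    case False
    then obtain z where z: "z \<in> carrier G" "ord z = p \<or> ord z = q"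
      "cyclic_group (subgroup_generated G {w, z})" "cyclic_group (subgroup_generated G {y, z})"
      using common_prime_ord[of w y] y y1 w by blast
    \<comment> \<open>A \<open>z\<close> of order \<open>p\<close> would be a power of
      \<open>x\<close> and would force \<open>x\<close> to commute with \<open>y\<close>.\<close>
    have "ord z \<noteq> p"
    proof
      assume "ord z = p"
      then have "cyclic_group (subgroup_generated G {x, z})"
        using uniq z assms cyclic_pair_generate by blast
      then show False using commute_if_cyclic_pair_ord_p z y assms \<open>ord z = p\<close> by blast
    qed
    \<comment> \<open>Now \<open>z\<close> and \<open>y0\<close> generate the same subgroup of order
      \<open>q\<close> below \<open>y\<close>, so the adjacency of \<open>w\<close> to
      \<open>z\<close> passes to \<open>y0\<close>.\<close>
    then have "y0 \<in> generate G {z}"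
      using cyclic_pair_prime_ord_eq[OF fin y(1) z(1) y0(2) z(4)] z y0 y \<open>q dvd ord y\<close> prime_q
        cyclic_pair_generate by blast
    then show ?thesis using cyclic_pair_mono[OF w z(1,3)] cyclic_pair_swap by blast
  qed
  then have "y0 \<in> cyclicizer G" using y0 by (simp add: cyclicizer_def)
  then show ?thesis using ord_prime_neq_one y0 by blast
qed

lemma cyclicizer_nontrivial:
  assumes "g \<in> carrier G" "g \<noteq> \<one>"
  shows "\<exists>z \<in> cyclicizer G. z \<noteq> \<one>"
proof -
  interpret swap: two_prime_group G q p by (rule two_prime_group_swap)
  obtain z where z: "z \<in> carrier G" "ord z = p \<or> ord z = q"
    using ex_prime_ord assms by blast
  have "(\<exists>x \<in> carrier G. ord x = p \<and> (\<forall>x' \<in> carrier G. ord x' = p \<longrightarrow> x' \<in> generate G {x})) \<or>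
    (\<exists>y \<in> carrier G. ord y = q \<and> (\<forall>y' \<in> carrier G. ord y' = q \<longrightarrow> y' \<in> generate G {y}))"
  proof (cases "(\<exists>x \<in> carrier G. ord x = p) \<and> (\<exists>y \<in> carrier G. ord y = q)")
    case True
    \<comment> \<open>For fixed \<open>x\<close> and \<open>y\<close>, one counterexample to each
      uniqueness claim would contradict the dichotomy.\<close>
    then show ?thesis using generate_eq_or_generate_eq by meson
  next
    case False
    then show ?thesis
      using z generate_eq_if_no_ord_q swap.generate_eq_if_no_ord_q by metis
  qed
  then show ?thesis
    using unique_ord_p_imp_cyclicizer swap.unique_ord_p_imp_cyclicizer by blast
qed

end

section \<open>Nonadjacent pairs in noncyclic groups\<close>

text \<open>An element \<open>g\<close> of maximal order generates everything: a cyclic subgroup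
  containing \<open>g\<close> and \<open>x\<close> cannot be larger than the one generated by
  \<open>g\<close>.\<close>

lemma (in group) cyclic_group_if_all_pairs:
  assumes "finite (carrier G)"
    and pairs: "\<And>x y. x \<in> carrier G \<Longrightarrow> y \<in> carrier G \<Longrightarrow> cyclic_group (subgroup_generated G {x, y})"
  shows "cyclic_group G"
proof -
  have "Max (ord ` carrier G) \<in> ord ` carrier G"
    by (rule Max_in) (use assms(1) carrier_not_empty in auto)
  then obtain g where g: "g \<in> carrier G" "ord g = Max (ord ` carrier G)" by force
  then have max: "ord x \<le> ord g" if "x \<in> carrier G" for x
    using assms(1) that by simp
  have "x \<in> generate G {g}" if x: "x \<in> carrier G" for x
  proof -
    obtain c where c: "c \<in> carrier G" "g \<in> generate G {c}" "x \<in> generate G {c}"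
      using pairs[OF g(1) x] cyclic_pair_iff[OF g(1) x] by blast
    have "generate G {g} \<subseteq> generate G {c}" using c generate_trans by blast
    moreover have "card (generate G {c}) \<le> card (generate G {g})"
      using max[OF c(1)] generate_pow_card c g by metis
    moreover have "finite (generate G {c})"
      using c assms(1) generate_incl[of "{c}"] finite_subset by (metis empty_subsetI insert_subset)
    ultimately show ?thesis using c card_seteq by blast
  qed
  then have "carrier G = range (\<lambda>n::int. g [^] n)"
    using generate_pow[OF g(1)] g(1) by auto
  then show ?thesis using cyclic_group g by blast
qed

section \<open>Distances up to 2 in terms of arcs\<close>

lemma graph_dist_le_2E:
  assumes "pair_wf_digraph \<Gamma>" "graph_dist \<Gamma> u v \<le> 2"
  obtains "u = v" | "(u, v) \<in> parcs \<Gamma>" | w where "(u, w) \<in> parcs \<Gamma>" "(w, v) \<in> parcs \<Gamma>"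
proof -
  interpret pair_wf_digraph \<Gamma> by fact
  \<comment> \<open>The strict bound yields an actual walk below the infimum bound 3; its cost is
    its length, hence at most 2.\<close>
  have "graph_dist \<Gamma> u v < 3" using assms(2) by (rule le_less_trans) simp
  then obtain es where es: "awalk u es v" "ereal (awalk_cost (\<lambda>_. 1) es) < 3"
    unfolding graph_dist_def \<mu>_def INF_less_iff by auto
  have "awalk_cost (\<lambda>_. 1) es = real (length es)" by (induction es) (auto simp: awalk_cost_def)
  with es have "ereal (length es) < ereal 3" by simp
  then have "length es < 3" by simp
  then consider "es = []" | e where "es = [e]" | e f where "es = [e, f]"
    by (cases es; cases "tl es"; cases "tl (tl es)") auto
  then show ?thesis
  proof cases
    case 1 then show ?thesis using that(1) es(1) by (simp add: awalk_simps)
  next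
    case (2 e) then show ?thesis using that(2) es(1) by (cases e) (simp add: awalk_simps)
  next
    case (3 e f) then show ?thesis using that(3) es(1) by (cases e; cases f) (auto simp: awalk_simps)
  qed
qed

lemma graph_dist_ge_2:
  assumes "pair_wf_digraph \<Gamma>" "u \<noteq> v" "(u, v) \<notin> parcs \<Gamma>"
  shows "graph_dist \<Gamma> u v \<ge> 2"
proof -
  interpret pair_wf_digraph \<Gamma> by fact
  show ?thesis unfolding graph_dist_def \<mu>_def
  proof (rule INF_greatest)
    fix es assume "es \<in> {es. awalk u es v}"
    then have "length es \<ge> 2"
      using assms by (cases es; cases "tl es") (auto simp: awalk_simps)
    moreover have "awalk_cost (\<lambda>_. 1) es = real (length es)"
      by (induction es) (auto simp: awalk_cost_def)
    ultimately have "ereal 2 \<le> ereal (awalk_cost (\<lambda>_. 1) es)" by simp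
    then show "2 \<le> ereal (awalk_cost (\<lambda>_. 1) es)" by simp
  qed
qed

lemma graph_dist_le_2:
  assumes "pair_wf_digraph \<Gamma>" "(u, w) \<in> parcs \<Gamma>" "(w, v) \<in> parcs \<Gamma>"
  shows "graph_dist \<Gamma> u v \<le> 2"
proof -
  interpret pair_wf_digraph \<Gamma> by fact
  have "awalk u [(u, w), (w, v)] v" using assms(2,3)
    by (auto simp: awalk_simps in_arcsD1 in_arcsD2)
  from min_cost_le_walk_cost[OF this, of "\<lambda>_. 1"] show ?thesis
    by (simp add: graph_dist_def)
qed

text \<open>A nontrivial universal element gives paths of length at most 2, while noncyclicity gives
  a nonadjacent pair. The other direction is \<open>cyclicizer_nontrivial\<close>.\<close>

theorem theorem2:
  fixes G :: "('a, 'b) monoid_scheme" and p q :: nat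
  assumes "prime p" and "prime q" and "p \<noteq> q"
    and "pi_group {p, q} G"
    and "\<not> cyclic_group G"
  shows "graph_diam (enhanced_power_graph G) = 2 \<longleftrightarrow> card (cyclicizer G) > 1"
proof -
  interpret group G using assms(4) by (simp add: pi_group_def)
  have fin: "finite (carrier G)" using assms(4) by (simp add: pi_group_def)
  let ?\<Gamma> = "enhanced_power_graph G"
  interpret g: pair_graph ?\<Gamma> using pair_graph_enhanced_power_graph fin by blast
  note wf = g.pair_wf_digraph_axioms
  have self: "cyclic_group (subgroup_generated G {x, x})" if "x \<in> carrier G" for x
    using cyclic_pair_generate that generate.incl by (metis singletonI)
  have one: "cyclic_group (subgroup_generated G {x, \<one>\<^bsub>G\<^esub>})" if "x \<in> carrier G" for x
    using cyclic_pair_generate that generate.one by metis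
  have verts: "pverts ?\<Gamma> = carrier G - {\<one>\<^bsub>G\<^esub>}" by (simp add: enhanced_power_graph_def)
  have arcs: "(x, y) \<in> parcs ?\<Gamma> \<longleftrightarrow> x \<in> carrier G - {\<one>\<^bsub>G\<^esub>} \<and> y \<in> carrier G - {\<one>\<^bsub>G\<^esub>} \<and> x \<noteq> y \<and>
      cyclic_group (subgroup_generated G {x, y})" for x y
    by (simp add: enhanced_power_graph_def)
  have "\<one>\<^bsub>G\<^esub> \<in> cyclicizer G" using one cyclic_pair_swap by (auto simp: cyclicizer_def)
  moreover have "finite (cyclicizer G)" using fin by (simp add: cyclicizer_def)
  ultimately have card: "card (cyclicizer G) > 1 \<longleftrightarrow> (\<exists>z \<in> cyclicizer G. z \<noteq> \<one>\<^bsub>G\<^esub>)"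
    by (metis One_nat_def card_le_Suc0_iff_eq not_le)
  show ?thesis unfolding card
  proof
    assume diam: "graph_diam ?\<Gamma> = 2"
    obtain g where g: "g \<in> carrier G" "g \<noteq> \<one>\<^bsub>G\<^esub>"
      using assms(5) trivial_imp_cyclic_group[of G] by (auto simp: trivial_group_def)
    have "two_prime_group G p q"
    proof
      show "r = p \<or> r = q" if "g \<in> carrier G" "prime r" "r dvd ord g" for g r
        using assms(4) that(2) dvd_trans[OF that(3) ord_dvd_group_order[OF that(1)]]
        unfolding pi_group_def by blast
      fix x y assume xy: "x \<in> carrier G" "y \<in> carrier G" "x \<noteq> \<one>\<^bsub>G\<^esub>" "y \<noteq> \<one>\<^bsub>G\<^esub>"
      then have "(x, y) \<in> pverts ?\<Gamma> \<times> pverts ?\<Gamma>" by (simp add: verts)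
      from SUP_upper[OF this, of "\<lambda>(u, v). graph_dist ?\<Gamma> u v"]
      have "graph_dist ?\<Gamma> x y \<le> 2" using diam by (simp add: graph_diam_def)
      from graph_dist_le_2E[OF wf this]
      show "\<exists>z \<in> carrier G. z \<noteq> \<one>\<^bsub>G\<^esub> \<and> cyclic_group (subgroup_generated G {x, z}) \<and>
        cyclic_group (subgroup_generated G {y, z})"
      proof cases
        \<comment> \<open>At distance 0 or 1 an endpoint serves as \<open>z\<close>.\<close>
        case 1 then show ?thesis using self xy by blast
      next
        case 2 then show ?thesis using self xy arcs by blast
      next
        case (3 w) then show ?thesis using arcs cyclic_pair_swap by blast
      qed
    qed (fact fin assms(1-3))+
    then show "\<exists>z \<in> cyclicizer G. z \<noteq> \<one>\<^bsub>G\<^esub>"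
      using two_prime_group.cyclicizer_nontrivial[OF _ g] by simp
  next
    assume "\<exists>z \<in> cyclicizer G. z \<noteq> \<one>\<^bsub>G\<^esub>"
    then obtain z where z: "z \<in> carrier G" "z \<noteq> \<one>\<^bsub>G\<^esub>"
      and univ: "\<And>g. g \<in> carrier G \<Longrightarrow> cyclic_group (subgroup_generated G {z, g})"
      by (auto simp: cyclicizer_def)
    obtain x y where xy: "x \<in> carrier G" "y \<in> carrier G"
      and ncyc: "\<not> cyclic_group (subgroup_generated G {x, y})"
      using cyclic_group_if_all_pairs fin assms(5) by blast
    have "x \<noteq> \<one>\<^bsub>G\<^esub>" "y \<noteq> \<one>\<^bsub>G\<^esub>" "x \<noteq> y" using ncyc xy one self cyclic_pair_swap by metis+
    then have "(x, y) \<in> pverts ?\<Gamma> \<times> pverts ?\<Gamma>" using xy by (simp add: verts)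
    from SUP_upper[OF this, of "\<lambda>(u, v). graph_dist ?\<Gamma> u v"]
    have "graph_dist ?\<Gamma> x y \<le> graph_diam ?\<Gamma>" by (simp add: graph_diam_def)
    moreover have "2 \<le> graph_dist ?\<Gamma> x y"
      using graph_dist_ge_2[OF wf \<open>x \<noteq> y\<close>] arcs ncyc by blast
    moreover have "graph_diam ?\<Gamma> \<le> 2" unfolding graph_diam_def
    proof (rule SUP_least, clarify)
      fix u v assume "u \<in> pverts ?\<Gamma>" "v \<in> pverts ?\<Gamma>"
      then have uv: "u \<in> carrier G - {\<one>\<^bsub>G\<^esub>}" "v \<in> carrier G - {\<one>\<^bsub>G\<^esub>}" by (simp_all add: verts)
      have le: "a \<le> 1 \<Longrightarrow> a \<le> (2::ereal)" for a by (erule order_trans) simp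
      \<comment> \<open>The graph has no loops, so the path through \<open>z\<close> requires that
        \<open>z\<close> is not an endpoint.\<close>
      consider "u = v" | "u \<noteq> v" "u = z \<or> v = z" | "u \<noteq> z" "v \<noteq> z" by blast
      then show "graph_dist ?\<Gamma> u v \<le> 2"
      proof cases
        case 1 then show ?thesis using graph_dist_self[OF wf] uv by (simp add: verts)
      next
        case 2
        then have "(u, v) \<in> parcs ?\<Gamma>" using arcs uv univ cyclic_pair_swap by blast
        then show ?thesis using graph_dist_le[OF wf] le by blast
      next
        case 3
        then have "(u, z) \<in> parcs ?\<Gamma>" "(z, v) \<in> parcs ?\<Gamma>"
          using arcs uv univ cyclic_pair_swap z by blast+
        then show ?thesis using graph_dist_le_2[OF wf] by blast
      qed
    qed
    ultimately show "graph_diam ?\<Gamma> = 2" by (metis order.trans antisym)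
  qed
qed

end
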